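(* Let $L>0$, $\mathbb{T}=\mathbb{R}/(L\mathbb{Z})$, and let $b,\sigma$ be smooth functions on $\mathbb{T}$ with $\sigma^2\ge S_1$ for some constant $S_1>0$. With the notation of the context, where $h=L/N$ for a positive integer $N$, there exist $h_0>0$ and $\kappa_1>0$ independent of $h$ such that for all $h\le h_0$ and all $t\ge 0$, $$\|q^h(t)-1\|_{\ell^2(\pi^h)}\le\|q^h(0)-1\|_{\ell^2(\pi^h)}\,e^{-\kappa_1t}.$$ Consequently $p^h(t)$ converges to $\pi^h$ exponentially fast in total variation norm, $\sum_j|p_j(t)-\pi^h_j|\le C\exp(-\kappa_1t)$, and thus $$\Big\|\rho^h(t)-\frac1h\|\rho^h(0)\|_{\ell^1}\,\pi^h\Big\|_{\ell^1}\le C\exp(-\kappa_1t),$$ where the constants $C$ are independent of $t$.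
   Context: Let $h=L/N$, $x_j=jh$, $0\le j\le N-1$, with all indices understood modulo $N$. Let $s=b-\sigma\sigma'$, $s_j^+=\max(s(x_j),0)$, $s_j^-=\max(-s(x_j),0)$, $\sigma_{j+1/2}=\sigma(x_j+h/2)$, and $$\alpha_j=\frac{s_j^+}{h}+\frac{\sigma_{j+1/2}^2}{2h^2},\qquad \beta_j=\frac{s_j^-}{h}+\frac{\sigma_{j-1/2}^2}{2h^2}.$$ The upwind scheme for the Fokker-Planck equation on $\mathbb{T}$ is $\frac{d}{dt}\rho_j=\alpha_{j-1}\rho_{j-1}+\beta_{j+1}\rho_{j+1}-(\alpha_j+\beta_j)\rho_j$, for $\rho^h(t)=(\rho_j(t))_{0\le j\le N-1}$, with $\rho_j(0)\ge0$ not all zero. $\|v\|_{\ell^1}=\sum_{j=0}^{N-1}h|v_j|$. The normalized sequence is $p^h(t)=(p_j(t))_j$, $p_j(t)=h\rho_j(t)/\|\rho^h(0)\|_{\ell^1}$, which solves the same equation. $\pi^h$ is the unique stationary solution of this equation with $\sum_j\pi^h_j=1$ (all its entries are positive). $q^h(t)=(q_j(t))_j$ with $q_j(t)=p_j(t)/\pi^h_j$, and $\|f\|_{\ell^2(\pi^h)}=(\sum_{j=0}^{N-1}\pi^h_j|f_j|^2)^{1/2}$; the scalar $1$ is subtracted from each entry. *)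

theory Defs
  imports "HOL-Analysis.Analysis"
begin

text \<open>Functions on the torus \<open>\<real>/L\<int>\<close> are represented by \<open>L\<close>-periodic functions on the real line.\<close>

definition smooth_on_torus :: "real \<Rightarrow> (real \<Rightarrow> real) \<Rightarrow> bool" where
  "smooth_on_torus L f \<longleftrightarrow>
     (\<forall>x. f (x + L) = f x) \<and> (\<forall>n x. (deriv ^^ n) f field_differentiable at x)"

text \<open>
  Grid functions \<open>(v\<^sub>j)\<close> with \<open>0 \<le> j \<le> N - 1\<close> and indices understood modulo \<open>N\<close> are
  represented by \<open>N\<close>-periodic functions on the integers, so that the shifts \<open>j - 1\<close> and
  \<open>j + 1\<close> need no reduction; sums run over one period.
\<close>

definition grid_fun :: "nat \<Rightarrow> (int \<Rightarrow> real) \<Rightarrow> bool" where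
  "grid_fun N v \<longleftrightarrow> (\<forall>j. v (j + int N) = v j)"

definition mesh :: "real \<Rightarrow> nat \<Rightarrow> real" where
  "mesh L N = L / real N"

definition grid_pt :: "real \<Rightarrow> nat \<Rightarrow> int \<Rightarrow> real" where
  "grid_pt L N j = of_int j * mesh L N"

definition drift :: "(real \<Rightarrow> real) \<Rightarrow> (real \<Rightarrow> real) \<Rightarrow> real \<Rightarrow> real" where
  "drift b \<sigma> x = b x - \<sigma> x * deriv \<sigma> x"

definition rate_right :: "real \<Rightarrow> nat \<Rightarrow> (real \<Rightarrow> real) \<Rightarrow> (real \<Rightarrow> real) \<Rightarrow> int \<Rightarrow> real" where
  "rate_right L N b \<sigma> j =
     max (drift b \<sigma> (grid_pt L N j)) 0 / mesh L N
     + (\<sigma> (grid_pt L N j + mesh L N / 2))\<^sup>2 / (2 * (mesh L N)\<^sup>2)"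

definition rate_left :: "real \<Rightarrow> nat \<Rightarrow> (real \<Rightarrow> real) \<Rightarrow> (real \<Rightarrow> real) \<Rightarrow> int \<Rightarrow> real" where
  "rate_left L N b \<sigma> j =
     max (- drift b \<sigma> (grid_pt L N j)) 0 / mesh L N
     + (\<sigma> (grid_pt L N j - mesh L N / 2))\<^sup>2 / (2 * (mesh L N)\<^sup>2)"

definition upwind_op ::
    "real \<Rightarrow> nat \<Rightarrow> (real \<Rightarrow> real) \<Rightarrow> (real \<Rightarrow> real) \<Rightarrow> (int \<Rightarrow> real) \<Rightarrow> int \<Rightarrow> real" where
  "upwind_op L N b \<sigma> v j =
     rate_right L N b \<sigma> (j - 1) * v (j - 1) + rate_left L N b \<sigma> (j + 1) * v (j + 1)
     - (rate_right L N b \<sigma> j + rate_left L N b \<sigma> j) * v j"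

text \<open>Only times \<open>t \<ge> 0\<close> are constrained; at \<open>t = 0\<close> the derivative is one-sided.\<close>

definition upwind_solution ::
    "real \<Rightarrow> nat \<Rightarrow> (real \<Rightarrow> real) \<Rightarrow> (real \<Rightarrow> real) \<Rightarrow> (real \<Rightarrow> int \<Rightarrow> real) \<Rightarrow> bool" where
  "upwind_solution L N b \<sigma> \<rho> \<longleftrightarrow>
     (\<forall>t\<ge>0. grid_fun N (\<rho> t)) \<and>
     (\<forall>t\<ge>0. \<forall>j. ((\<lambda>u. \<rho> u j) has_real_derivative upwind_op L N b \<sigma> (\<rho> t) j) (at t within {0..}))"

text \<open>
  The description is meaningful when the rates are positive, e.g. when \<open>\<sigma>\<close> has no zeros:
  the chain is then irreducible and the stationary solution of total mass \<open>1\<close> is unique.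
\<close>

definition stationary ::
    "real \<Rightarrow> nat \<Rightarrow> (real \<Rightarrow> real) \<Rightarrow> (real \<Rightarrow> real) \<Rightarrow> (int \<Rightarrow> real)" where
  "stationary L N b \<sigma> =
     (THE \<pi>. grid_fun N \<pi> \<and> (\<forall>j. upwind_op L N b \<sigma> \<pi> j = 0) \<and> (\<Sum>j\<in>{0..<int N}. \<pi> j) = 1)"

definition l1_norm :: "real \<Rightarrow> nat \<Rightarrow> (int \<Rightarrow> real) \<Rightarrow> real" where
  "l1_norm L N v = (\<Sum>j\<in>{0..<int N}. mesh L N * \<bar>v j\<bar>)"

definition weighted_l2_norm :: "nat \<Rightarrow> (int \<Rightarrow> real) \<Rightarrow> (int \<Rightarrow> real) \<Rightarrow> real" where
  "weighted_l2_norm N w f = sqrt (\<Sum>j\<in>{0..<int N}. w j * \<bar>f j\<bar>\<^sup>2)"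

definition normalized :: "real \<Rightarrow> nat \<Rightarrow> (real \<Rightarrow> int \<Rightarrow> real) \<Rightarrow> real \<Rightarrow> int \<Rightarrow> real" where
  "normalized L N \<rho> t j = mesh L N * \<rho> t j / l1_norm L N (\<rho> 0)"

definition rel_density ::
    "real \<Rightarrow> nat \<Rightarrow> (real \<Rightarrow> real) \<Rightarrow> (real \<Rightarrow> real) \<Rightarrow> (real \<Rightarrow> int \<Rightarrow> real) \<Rightarrow> real \<Rightarrow> int \<Rightarrow> real" where
  "rel_density L N b \<sigma> \<rho> t j = normalized L N \<rho> t j / stationary L N b \<sigma> j"

end

theory Submission
  imports Defs
begin

text \<open>
  The stationary flux \<open>J = \<alpha>\<^sub>j \<pi>\<^sub>j - \<beta>\<^sub>j\<^sub>+\<^sub>1 \<pi>\<^sub>j\<^sub>+\<^sub>1\<close> does not depend on \<open>j\<close>. Its sign makes one of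
  \<open>\<pi>\<^sub>j\<^sub>+\<^sub>1 \<le> (\<alpha>\<^sub>j / \<beta>\<^sub>j\<^sub>+\<^sub>1) \<pi>\<^sub>j\<close> and \<open>\<pi>\<^sub>j \<le> (\<beta>\<^sub>j\<^sub>+\<^sub>1 / \<alpha>\<^sub>j) \<pi>\<^sub>j\<^sub>+\<^sub>1\<close> hold for all \<open>j\<close>, and both quotients
  are at most \<open>1 + C h\<close>. Following the circle in this one direction reaches every index, so
  \<open>max \<pi> \<le> (1 + C h)\<^sup>N min \<pi> \<le> exp (C L) min \<pi>\<close>. As the rates are at least \<open>S\<^sub>1 / (2 h\<^sup>2)\<close>, the
  Cauchy-Schwarz inequality along the circle then yields a Poincare inequality with a constant
  independent of \<open>h\<close>. The antisymmetric part of the generator drops out of the energy identity,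
  again because \<open>J\<close> is constant, and the Gronwall inequality gives the decay with
  \<open>\<kappa>\<^sub>1 = S\<^sub>1 / (2 exp (C L) L\<^sup>2)\<close>.
\<close>

section \<open>Periodic functions on the integers\<close>

lemma grid_funD: "grid_fun N v \<Longrightarrow> v (j + int N) = v j"
  by (simp add: grid_fun_def)

lemma grid_fun_shift:
  assumes "grid_fun N v"
  shows "grid_fun N (\<lambda>j. v (j + c))"
  unfolding grid_fun_def
proof
  fix j
  show "v (j + int N + c) = v (j + c)"
    using grid_funD[OF assms, of "j + c"] by (simp add: algebra_simps)
qed

lemma grid_fun_add_mult:
  assumes "grid_fun N v"
  shows "v (j + int k * int N) = v j"
proof (induction k)
  case (Suc k)
  then show ?case
    using grid_funD[OF assms, of "j + int k * int N"] by (simp add: algebra_simps)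
qed simp

lemma grid_fun_mod:
  assumes "grid_fun N v"
  shows "v (j mod int N) = v j"
proof (cases "j div int N \<ge> 0")
  case True
  then show ?thesis
    using grid_fun_add_mult[OF assms, of "j mod int N" "nat (j div int N)"] by simp
next
  case False
  then have "j mod int N = j + int (nat (- (j div int N))) * int N"
    by (simp add: minus_div_mult_eq_mod [symmetric])
  then show ?thesis
    using grid_fun_add_mult[OF assms, of j "nat (- (j div int N))"] by simp
qed

text \<open>Upward steps suffice, since \<open>i + (j - i) mod int N\<close> is at least
  \<open>i\<close> and congruent to \<open>j\<close>. One-sided implications can thus be carried
  round the whole circle.\<close>

lemma grid_fun_induct:
  assumes "grid_fun N v" "N > 0"
    and "P (v i)" and "\<And>j. P (v j) \<Longrightarrow> P (v (j + 1))"
  shows "P (v j)"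
proof -
  have up: "P (v (i + int k))" for k
  proof (induction k)
    case (Suc k)
    then show ?case using assms(4)[of "i + int k"] by (simp add: ac_simps)
  qed (simp add: assms(3))
  have "v (i + int (nat ((j - i) mod int N))) = v j"
    using assms(2) grid_fun_mod[OF assms(1), of j]
      grid_fun_mod[OF assms(1), of "i + (j - i) mod int N"] by (simp add: mod_simps)
  then show ?thesis using up by metis
qed

lemma sum_grid_fun_shift:
  fixes f :: "int \<Rightarrow> real"
  assumes "grid_fun N f"
  shows "(\<Sum>j\<in>{0..<int N}. f (j + 1)) = (\<Sum>j\<in>{0..<int N}. f j)"
proof (cases "N = 0")
  case False
  have "(\<Sum>j\<in>{0..<int N}. f (j + 1)) = (\<Sum>j\<in>{1..<int N + 1}. f j)"
    by (rule sum.reindex_bij_witness[of _ "\<lambda>j. j - 1" "\<lambda>j. j + 1"]) auto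
  also have "{1..<int N + 1} = insert (int N) {1..<int N}"
    using False by auto
  also have "sum f \<dots> = f (int N) + (\<Sum>j\<in>{1..<int N}. f j)"
    by simp
  also have "f (int N) = f 0"
    using grid_funD[OF assms, of 0] by simp
  also have "f 0 + (\<Sum>j\<in>{1..<int N}. f j) = sum f (insert 0 {1..<int N})"
    by simp
  also have "insert 0 {1..<int N} = {0..<int N}"
    using False by auto
  finally show ?thesis .
qed simp

section \<open>A Poincare inequality on the discrete circle\<close>

lemma sum_diff_telescope_int:
  fixes f :: "int \<Rightarrow> real"
  assumes "i \<le> j"
  shows "(\<Sum>k\<in>{i..<j}. f (k + 1) - f k) = f j - f i"
  using assms
proof (induction j rule: int_ge_induct)
  case (step j)
  then have "{i..<j + 1} = insert j {i..<j}" by auto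
  then show ?case using step by simp
qed simp

text \<open>Telescope along the arc from the smaller to the larger index, then apply Cauchy-Schwarz
  to its at most \<open>N\<close> increments.\<close>

lemma square_diff_le_sum_squares:
  fixes f :: "int \<Rightarrow> real"
  assumes "i \<in> {0..<int N}" "j \<in> {0..<int N}"
  shows "(f i - f j)\<^sup>2 \<le> real N * (\<Sum>k\<in>{0..<int N}. (f (k + 1) - f k)\<^sup>2)"
proof -
  have *: "(f j - f i)\<^sup>2 \<le> real N * (\<Sum>k\<in>{0..<int N}. (f (k + 1) - f k)\<^sup>2)"
    if "i \<in> {0..<int N}" "j \<in> {0..<int N}" "i \<le> j" for i j
  proof -
    have "(f j - f i)\<^sup>2 = (\<Sum>k\<in>{i..<j}. f (k + 1) - f k)\<^sup>2"
      by (simp add: sum_diff_telescope_int that)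
    also have "\<dots> \<le> (\<Sum>k\<in>{i..<j}. (f (k + 1) - f k)\<^sup>2) * card {i..<j}"
      by (rule sum_squared_le_sum_of_squares)
    also have "\<dots> \<le> (\<Sum>k\<in>{0..<int N}. (f (k + 1) - f k)\<^sup>2) * real N"
      using that by (intro mult_mono sum_mono2 sum_nonneg) auto
    finally show ?thesis by (simp add: mult.commute)
  qed
  show ?thesis
    using *[of i j] *[of j i] assms by (cases "i \<le> j") (auto simp: power2_commute)
qed

text \<open>Compare with the value \<open>f 0\<close>: by mass one and mean zero, the weighted sum
  of \<open>(f 0 - f j)\<^sup>2\<close> exceeds that of \<open>(f j)\<^sup>2\<close> by
  \<open>(f 0)\<^sup>2\<close>, and \<open>square_diff_le_sum_squares\<close> bounds each
  difference.\<close>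

lemma circle_Poincare:
  fixes f w :: "int \<Rightarrow> real"
  assumes "N > 0" and "\<And>j. w j \<ge> 0"
    and "(\<Sum>j\<in>{0..<int N}. w j) = 1" and "(\<Sum>j\<in>{0..<int N}. w j * f j) = 0"
  shows "(\<Sum>j\<in>{0..<int N}. w j * (f j)\<^sup>2)
    \<le> real N * (\<Sum>j\<in>{0..<int N}. (f (j + 1) - f j)\<^sup>2)"
proof -
  define E where "E = real N * (\<Sum>k\<in>{0..<int N}. (f (k + 1) - f k)\<^sup>2)"
  have "(\<Sum>j\<in>{0..<int N}. w j * (f j)\<^sup>2) \<le> (f 0)\<^sup>2 + (\<Sum>j\<in>{0..<int N}. w j * (f j)\<^sup>2)"
    by simp
  also have "\<dots> = (f 0)\<^sup>2 * (\<Sum>j\<in>{0..<int N}. w j) - 2 * f 0 * (\<Sum>j\<in>{0..<int N}. w j * f j)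
      + (\<Sum>j\<in>{0..<int N}. w j * (f j)\<^sup>2)"
    using assms(3,4) by simp
  also have "\<dots> = (\<Sum>j\<in>{0..<int N}. w j * (f 0 - f j)\<^sup>2)"
    by (simp add: sum_distrib_left sum_subtractf[symmetric] sum.distrib[symmetric]
        power2_eq_square algebra_simps)
  also have "\<dots> \<le> (\<Sum>j\<in>{0..<int N}. w j * E)"
    unfolding E_def using assms(1,2)
    by (intro sum_mono mult_left_mono square_diff_le_sum_squares) auto
  also have "\<dots> = E"
    using assms(3) by (simp add: sum_distrib_right[symmetric])
  finally show ?thesis unfolding E_def .
qed

text \<open>Gronwall inequality: \<open>F t * exp (c * t)\<close> is nonincreasing.\<close>

lemma exponential_decay:
  fixes F F' :: "real \<Rightarrow> real"
  assumes F: "\<And>t. t \<ge> 0 \<Longrightarrow> (F has_real_derivative F' t) (at t within {0..})"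
    and le: "\<And>t. t \<ge> 0 \<Longrightarrow> F' t \<le> - c * F t"
    and "t \<ge> 0"
  shows "F t \<le> F 0 * exp (- c * t)"
proof -
  define G where "G = (\<lambda>t. F t * exp (c * t))"
  have G: "(G has_real_derivative (F' t + c * F t) * exp (c * t)) (at t within {0..})"
    if "t \<ge> 0" for t
    unfolding G_def by (rule derivative_eq_intros F[OF that] refl)+ (simp add: algebra_simps)
  \<comment> \<open>At \<open>0\<close> the derivative is only one-sided, so its sign is used on the
    open interval and continuity reaches the endpoints.\<close>
  have "G t \<le> G 0"
  proof (rule DERIV_nonpos_imp_decreasing_open[OF \<open>t \<ge> 0\<close>])
    fix x :: real assume "0 < x" "x < t"
    then have "at x within {0..} = at x" by (intro at_within_interior) simp
    then have "(G has_real_derivative (F' x + c * F x) * exp (c * x)) (at x)"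
      using G[of x] \<open>0 < x\<close> by simp
    moreover have "(F' x + c * F x) * exp (c * x) \<le> 0"
      using le[of x] \<open>0 < x\<close> by (intro mult_nonpos_nonneg) auto
    ultimately show "\<exists>y. (G has_real_derivative y) (at x) \<and> y \<le> 0" by blast
  next
    have "continuous_on {0..} G"
      using G by (intro DERIV_continuous_on) auto
    then show "continuous_on {0..t} G"
      by (rule continuous_on_subset) auto
  qed
  then have "F t * exp (c * t) * exp (- (c * t)) \<le> F 0 * exp (- (c * t))"
    unfolding G_def by (intro mult_right_mono) auto
  then show ?thesis by (simp add: mult.assoc exp_add[symmetric])
qed

section \<open>Nearest-neighbour chains on a circle\<close>

text \<open>\<open>\<alpha> j\<close> is the jump rate from \<open>j\<close> to
  \<open>j + 1\<close>, \<open>\<beta> j\<close> that from \<open>j\<close> to \<open>j - 1\<close>.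
  The rates stay abstract so that the chain reflected at \<open>0\<close> is an instance as
  well.\<close>

locale cyclic_chain =
  fixes N :: nat and \<alpha> \<beta> :: "int \<Rightarrow> real"
  assumes N_pos: "N > 0"
    and rates_pos: "\<alpha> j > 0" "\<beta> j > 0"
    and rates_periodic: "grid_fun N \<alpha>" "grid_fun N \<beta>"
begin

definition generator :: "(int \<Rightarrow> real) \<Rightarrow> int \<Rightarrow> real" where
  "generator v j = \<alpha> (j - 1) * v (j - 1) + \<beta> (j + 1) * v (j + 1) - (\<alpha> j + \<beta> j) * v j"

text \<open>Net mass flow across the edge from \<open>j\<close> to \<open>j + 1\<close>.\<close>

definition flux :: "(int \<Rightarrow> real) \<Rightarrow> int \<Rightarrow> real" where
  "flux v j = \<alpha> j * v j - \<beta> (j + 1) * v (j + 1)"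

lemma generator_eq_flux: "generator v j = flux v (j - 1) - flux v j"
  by (simp add: generator_def flux_def algebra_simps)

lemma flux_uminus: "flux (\<lambda>j. - v j) j = - flux v j"
  by (simp add: flux_def)

lemma grid_fun_flux:
  assumes "grid_fun N v"
  shows "grid_fun N (flux v)"
  using assms rates_periodic(1) grid_fun_shift[OF assms, of 1] grid_fun_shift[OF rates_periodic(2), of 1]
  by (simp add: grid_fun_def flux_def)

lemma flux_const:
  assumes "\<And>j. generator v j = 0"
  shows "flux v j = flux v 0"
proof (induction j rule: int_induct[where k = 0])
  case base
  show ?case by simp
next
  case (step1 i)
  then show ?case using assms[of "i + 1"] by (simp add: generator_eq_flux)
next
  case (step2 i)
  then show ?case using assms[of i] by (simp add: generator_eq_flux)
qed

text \<open>Periodicity allows the inflow terms to be shifted by one index without boundary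
  terms.\<close>

lemma sum_by_parts:
  assumes "grid_fun N v" "grid_fun N f"
  shows "(\<Sum>j\<in>{0..<int N}. f j * generator v j) = (\<Sum>j\<in>{0..<int N}. flux v j * (f (j + 1) - f j))"
proof -
  have "grid_fun N (\<lambda>j. f j * flux v (j - 1))"
    using assms(2) grid_fun_shift[OF grid_fun_flux[OF assms(1)], of "-1"]
    by (simp add: grid_fun_def)
  from sum_grid_fun_shift[OF this]
  have "(\<Sum>j\<in>{0..<int N}. f j * flux v (j - 1)) = (\<Sum>j\<in>{0..<int N}. f (j + 1) * flux v j)"
    by simp
  then show ?thesis
    by (simp add: generator_eq_flux algebra_simps sum_subtractf)
qed

lemma sum_generator:
  assumes "grid_fun N v"
  shows "(\<Sum>j\<in>{0..<int N}. generator v j) = 0"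
  using sum_by_parts[OF assms, of "\<lambda>_. 1"] by (simp add: grid_fun_def)

section \<open>Constant-flux solutions: sign and existence\<close>

text \<open>From \<open>\<beta> (j + 1) * v (j + 1) = \<alpha> j * v j - J\<close> with
  \<open>J \<ge> 0\<close>, both \<open>v j \<le> 0\<close> and \<open>v j < 0\<close> pass on to
  \<open>j + 1\<close>, hence to the whole circle.\<close>

lemma nonneg_flux_sign:
  assumes v: "grid_fun N v" and J: "\<And>j. flux v j = J" "J \<ge> 0"
  shows "(\<forall>j. v j > 0) \<or> (\<forall>j. v j = 0) \<or> (\<forall>j. v j < 0)"
proof (cases "\<exists>i. v i \<le> 0")
  case True
  then obtain i where i: "v i \<le> 0" by blast
  have rec: "\<beta> (j + 1) * v (j + 1) = \<alpha> j * v j - J" for j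
    using J(1)[of j] by (simp add: flux_def)
  have step: "v (j + 1) \<le> 0" if "v j \<le> 0" for j
    using rec[of j] rates_pos[of j] rates_pos[of "j + 1"] J(2) that
    by (smt (verit) mult_pos_pos mult_nonneg_nonpos)
  have le: "v j \<le> 0" for j
    using grid_fun_induct[OF v N_pos, of "\<lambda>x. x \<le> 0", OF i step] .
  have strict: "v (j + 1) < 0" if "v j < 0" for j
    using rec[of j] rates_pos[of j] rates_pos[of "j + 1"] J(2) that
    by (smt (verit) mult_pos_neg mult_nonneg_nonneg)
  show ?thesis
  proof (cases "\<exists>i. v i < 0")
    case True
    then obtain k where "v k < 0" by blast
    then have "\<forall>j. v j < 0"
      using grid_fun_induct[OF v N_pos, of "\<lambda>x. x < 0", OF _ strict] by blast
    then show ?thesis by blast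
  next
    case False
    then have "\<forall>j. v j = 0" using le by (meson antisym not_less)
    then show ?thesis by blast
  qed
qed (auto simp: not_le)

text \<open>For \<open>J < 0\<close> pass to \<open>- v\<close>, which reverses the flux. This
  trichotomy drives existence, uniqueness and positivity of the stationary distribution.\<close>

lemma const_flux_sign:
  assumes v: "grid_fun N v" and J: "\<And>j. flux v j = J"
  shows "(\<forall>j. v j > 0) \<or> (\<forall>j. v j = 0) \<or> (\<forall>j. v j < 0)"
proof (cases "J \<ge> 0")
  case True
  then show ?thesis using nonneg_flux_sign assms by blast
next
  case False
  have "(\<forall>j. - v j > 0) \<or> (\<forall>j. - v j = 0) \<or> (\<forall>j. - v j < 0)"
  proof (rule nonneg_flux_sign)
    show "grid_fun N (\<lambda>j. - v j)" using v by (simp add: grid_fun_def)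
    show "flux (\<lambda>j. - v j) j = - J" for j by (simp add: flux_uminus J)
  qed (use False in simp)
  then show ?thesis by auto
qed

text \<open>
  The solutions of \<open>\<alpha>\<^sub>j v\<^sub>j - \<beta>\<^sub>j\<^sub>+\<^sub>1 v\<^sub>j\<^sub>+\<^sub>1 = J\<close> are \<open>v\<^sub>0 A\<^sub>j - J B\<^sub>j\<close> with
  \<open>A = hom_sol\<close> and \<open>B = inhom_sol\<close>. The choice
  \<open>v\<^sub>0 = B\<^sub>N\<close>, \<open>J = A\<^sub>N - 1\<close> gives \<open>v\<^sub>N = v\<^sub>0\<close>.
\<close>

fun hom_sol :: "nat \<Rightarrow> real" where
  "hom_sol 0 = 1"
| "hom_sol (Suc n) = \<alpha> (int n) * hom_sol n / \<beta> (int n + 1)"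

fun inhom_sol :: "nat \<Rightarrow> real" where
  "inhom_sol 0 = 0"
| "inhom_sol (Suc n) = (\<alpha> (int n) * inhom_sol n + 1) / \<beta> (int n + 1)"

text \<open>Makes the starting value of the periodic solution nonzero.\<close>

lemma inhom_sol_pos:
  assumes "n > 0"
  shows "inhom_sol n > 0"
proof -
  have nonneg: "inhom_sol n \<ge> 0" for n
    by (induction n) (auto intro!: divide_nonneg_pos add_nonneg_nonneg mult_nonneg_nonneg
        simp: rates_pos less_imp_le)
  show ?thesis
    using assms nonneg by (cases n) (auto intro!: divide_pos_pos add_nonneg_pos mult_nonneg_nonneg
        simp: rates_pos less_imp_le)
qed

lemma const_flux_exists:
  obtains v J where "grid_fun N v" "\<And>j. flux v j = J" "v 0 \<noteq> 0"
proof -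
  define J where "J = hom_sol N - 1"
  define w where "w n = inhom_sol N * hom_sol n - J * inhom_sol n" for n
  define v where "v j = w (nat (j mod int N))" for j
  have w0: "w 0 = inhom_sol N" and wN: "w N = w 0"
    by (simp_all add: w_def J_def algebra_simps)
  have w_rec: "\<alpha> (int n) * w n - \<beta> (int n + 1) * w (Suc n) = J" for n
    using rates_pos(2)[of "int n + 1"] by (simp add: w_def field_simps)
  have v: "grid_fun N v"
    by (simp add: grid_fun_def v_def)
  have "flux v j = J" if "0 \<le> j" "j < int N" for j
  proof -
    have "v j = w (nat j)" using that by (simp add: v_def)
    \<comment> \<open>At \<open>j = N - 1\<close> the index wraps to \<open>0\<close>, and the
      closing condition \<open>wN\<close> supplies the missing value.\<close>
    moreover have "v (j + 1) = w (Suc (nat j))"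
    proof (cases "j + 1 < int N")
      case True
      then show ?thesis using that by (simp add: v_def nat_add_distrib)
    next
      case False
      then have "j + 1 = int N" "Suc (nat j) = N" using that by auto
      then show ?thesis using wN by (simp add: v_def)
    qed
    ultimately show ?thesis
      using w_rec[of "nat j"] that by (simp add: flux_def)
  qed
  then have "flux v j = J" for j
    using grid_fun_mod[OF grid_fun_flux[OF v], of j] N_pos
    by (metis of_nat_0_less_iff pos_mod_bound pos_mod_sign)
  moreover have "v 0 \<noteq> 0"
    using inhom_sol_pos[OF N_pos] w0 by (simp add: v_def)
  ultimately show ?thesis using v that by blast
qed

section \<open>The stationary distribution\<close>

definition is_stationary :: "(int \<Rightarrow> real) \<Rightarrow> bool" where
  "is_stationary v \<longleftrightarrow> grid_fun N v \<and> (\<forall>j. generator v j = 0) \<and> (\<Sum>j\<in>{0..<int N}. v j) = 1"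

text \<open>The difference of two solutions has constant flux, hence one sign throughout; its total
  mass zero leaves only the zero function.\<close>

lemma stationary_unique:
  assumes "is_stationary v" "is_stationary w"
  shows "v = w"
proof -
  define u where "u j = v j - w j" for j
  have u: "grid_fun N u" and sum: "(\<Sum>j\<in>{0..<int N}. u j) = 0"
    using assms by (auto simp: u_def is_stationary_def grid_fun_def sum_subtractf)
  have "generator u j = generator v j - generator w j" for j
    by (simp add: u_def generator_def algebra_simps)
  then have gen: "generator u j = 0" for j
    using assms by (simp add: is_stationary_def)
  have "{0..<int N} \<noteq> {}" using N_pos by simp
  then have "\<not> (\<forall>j. u j > 0)" "\<not> (\<forall>j. u j < 0)"
    using sum sum_pos[of "{0..<int N}" u] sum_pos[of "{0..<int N}" "\<lambda>j. - u j"]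
    by (auto simp: sum_negf)
  then have "\<forall>j. u j = 0"
    using const_flux_sign[OF u flux_const[OF gen]] by blast
  then show ?thesis by (auto simp: u_def fun_eq_iff)
qed

text \<open>A nonzero constant-flux solution has one strict sign, so its total mass is nonzero and
  can be divided out.\<close>

lemma stationary_exists: "\<exists>v. is_stationary v"
proof -
  obtain v J where v: "grid_fun N v" "\<And>j. flux v j = J" "v 0 \<noteq> 0"
    using const_flux_exists by blast
  define S where "S = (\<Sum>j\<in>{0..<int N}. v j)"
  have "{0..<int N} \<noteq> {}" using N_pos by simp
  moreover have "(\<forall>j. v j > 0) \<or> (\<forall>j. v j < 0)"
    using const_flux_sign[OF v(1,2)] v(3) by blast
  ultimately have "S \<noteq> 0"
    using sum_pos[of "{0..<int N}" v] sum_pos[of "{0..<int N}" "\<lambda>j. - v j"]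
    by (auto simp: sum_negf S_def)
  have "generator (\<lambda>j. v j / S) j = generator v j / S" for j
    by (simp add: generator_def algebra_simps diff_divide_distrib add_divide_distrib)
  then have "is_stationary (\<lambda>j. v j / S)"
    using v \<open>S \<noteq> 0\<close> unfolding is_stationary_def
    by (simp add: generator_eq_flux grid_fun_def sum_divide_distrib[symmetric] S_def)
  then show ?thesis by blast
qed

lemma stationary_pos:
  assumes "is_stationary v"
  shows "v j > 0"
proof -
  have v: "grid_fun N v" "\<And>j. generator v j = 0" "(\<Sum>j\<in>{0..<int N}. v j) = 1"
    using assms by (auto simp: is_stationary_def)
  have "\<not> (\<forall>j. v j \<le> 0)"
    using v(3) sum_nonpos[of "{0..<int N}" v] by auto
  then show ?thesis
    using const_flux_sign[OF v(1) flux_const[OF v(2)]] by (auto simp: less_imp_le)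
qed

section \<open>Harnack inequality with a bound on the rate ratios\<close>

text \<open>Nonnegative flux means that a step to the right costs at most a factor \<open>r\<close>.
  Nothing is known about steps to the left, so \<open>i\<close> is reached from \<open>j\<close> by
  going right, round the circle if necessary.\<close>

lemma nonneg_flux_Harnack:
  assumes v: "grid_fun N v" "\<And>j. v j > 0"
    and J: "\<And>j. flux v j \<ge> 0"
    and r: "\<And>j. \<alpha> j \<le> r * \<beta> (j + 1)" "r \<ge> 1"
  shows "v i \<le> r ^ N * v j"
proof -
  have step: "v (j + 1) \<le> r * v j" for j
  proof -
    have "\<beta> (j + 1) * v (j + 1) \<le> \<alpha> j * v j" using J[of j] by (simp add: flux_def)
    also have "\<dots> \<le> r * \<beta> (j + 1) * v j"
      using r(1) v(2)[of j] by (simp add: mult_right_mono less_imp_le)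
    finally have "\<beta> (j + 1) * v (j + 1) \<le> \<beta> (j + 1) * (r * v j)" by (simp add: mult_ac)
    then show ?thesis using rates_pos(2)[of "j + 1"] by simp
  qed
  have up: "v (j + int k) \<le> r ^ k * v j" for k
  proof (induction k)
    case (Suc k)
    have "v (j + int (Suc k)) \<le> r * v (j + int k)"
      using step[of "j + int k"] by (simp add: ac_simps)
    also have "\<dots> \<le> r * (r ^ k * v j)" using Suc r(2) by (intro mult_left_mono) auto
    finally show ?case by (simp add: mult_ac)
  qed simp
  define k where "k = nat ((i - j) mod int N)"
  have "(j + (i - j) mod int N) mod int N = i mod int N" by (simp add: mod_simps)
  then have "v i = v (j + int k)"
    using N_pos grid_fun_mod[OF v(1), of i] grid_fun_mod[OF v(1), of "j + int k"]
    by (simp add: k_def)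
  also have "\<dots> \<le> r ^ k * v j" by (rule up)
  also have "k \<le> N" using N_pos pos_mod_bound[of "int N" "i - j"] unfolding k_def by linarith
  then have "r ^ k * v j \<le> r ^ N * v j"
    using r(2) v(2)[of j] by (intro mult_right_mono power_increasing) auto
  finally show ?thesis .
qed

lemma grid_fun_reflect:
  assumes "grid_fun N f"
  shows "grid_fun N (\<lambda>j. f (c - j))"
  unfolding grid_fun_def
proof
  fix j
  show "f (c - (j + int N)) = f (c - j)"
    using grid_funD[OF assms, of "c - (j + int N)"] by (simp add: algebra_simps)
qed

text \<open>The stationary flux has one sign. If it is negative, reflection of the circle swaps the
  two rates and makes it positive.\<close>

lemma stationary_Harnack:
  assumes v: "is_stationary v"
    and r: "\<And>j. \<alpha> j \<le> r * \<beta> (j + 1)" "\<And>j. \<beta> (j + 1) \<le> r * \<alpha> j" "r \<ge> 1"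
  shows "v i \<le> r ^ N * v j"
proof (cases "flux v 0 \<ge> 0")
  case True
  then have "flux v j \<ge> 0" for j
    using flux_const[of v j] v by (simp add: is_stationary_def)
  then show ?thesis
    using nonneg_flux_Harnack[of v r i j] v stationary_pos[OF v] r by (auto simp: is_stationary_def)
next
  case False
  interpret refl: cyclic_chain N "\<lambda>j. \<beta> (- j)" "\<lambda>j. \<alpha> (- j)"
    using N_pos rates_pos grid_fun_reflect[OF rates_periodic(1), of 0]
      grid_fun_reflect[OF rates_periodic(2), of 0]
    by unfold_locales auto
  \<comment> \<open>The reflected edge from \<open>j\<close> to \<open>j + 1\<close> is the original
    edge from \<open>- j - 1\<close> to \<open>- j\<close>, run backwards.\<close>
  have "refl.flux (\<lambda>j. v (- j)) j = - flux v (- j - 1)" for j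
    by (simp add: refl.flux_def flux_def minus_diff_commute)
  then have "refl.flux (\<lambda>j. v (- j)) j \<ge> 0" for j
    using False flux_const[of v "- j - 1"] v by (simp add: is_stationary_def)
  moreover have "\<beta> (- j) \<le> r * \<alpha> (- (j + 1))" for j
    using r(2)[of "- j - 1"] by (simp add: minus_diff_commute)
  ultimately show ?thesis
    using refl.nonneg_flux_Harnack[of "\<lambda>j. v (- j)" r "- i" "- j"] v stationary_pos[OF v] r(3)
      grid_fun_reflect[of v 0]
    by (simp add: is_stationary_def)
qed

section \<open>Energy dissipation and decay\<close>

text \<open>The part of the flux carrying \<open>flux \<pi>\<close> is tested against increments of
  \<open>f\<^sup>2\<close>; summing by parts back turns it into \<open>generator \<pi>\<close>,
  which vanishes. Only the symmetric part remains.\<close>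

lemma dissipation_identity:
  assumes \<pi>: "is_stationary \<pi>" and f: "grid_fun N f"
  shows "2 * (\<Sum>j\<in>{0..<int N}. f j * generator (\<lambda>j. \<pi> j * f j) j)
    = - (\<Sum>j\<in>{0..<int N}. (\<alpha> j * \<pi> j + \<beta> (j + 1) * \<pi> (j + 1)) * (f (j + 1) - f j)\<^sup>2)"
proof -
  have \<pi>': "grid_fun N \<pi>" "\<And>j. generator \<pi> j = 0" using \<pi> by (auto simp: is_stationary_def)
  have "grid_fun N (\<lambda>j. \<pi> j * f j)" "grid_fun N (\<lambda>j. (f j)\<^sup>2)"
    using \<pi>' f by (auto simp: grid_fun_def)
  note parts = sum_by_parts[OF this(1) f] sum_by_parts[OF \<pi>'(1) this(2)]
  \<comment> \<open>Write \<open>f j\<close> and \<open>f (j + 1)\<close> as their mean minus and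
    plus half their difference.\<close>
  have pointwise: "2 * (flux (\<lambda>j. \<pi> j * f j) j * (f (j + 1) - f j))
      = flux \<pi> j * ((f (j + 1))\<^sup>2 - (f j)\<^sup>2)
        - (\<alpha> j * \<pi> j + \<beta> (j + 1) * \<pi> (j + 1)) * (f (j + 1) - f j)\<^sup>2" for j
    by (simp add: flux_def power2_eq_square algebra_simps)
  have "2 * (\<Sum>j\<in>{0..<int N}. f j * generator (\<lambda>j. \<pi> j * f j) j)
      = (\<Sum>j\<in>{0..<int N}. flux \<pi> j * ((f (j + 1))\<^sup>2 - (f j)\<^sup>2))
        - (\<Sum>j\<in>{0..<int N}. (\<alpha> j * \<pi> j + \<beta> (j + 1) * \<pi> (j + 1)) * (f (j + 1) - f j)\<^sup>2)"
    by (simp add: parts(1) sum_distrib_left pointwise sum_subtractf)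
  also have "(\<Sum>j\<in>{0..<int N}. flux \<pi> j * ((f (j + 1))\<^sup>2 - (f j)\<^sup>2)) = 0"
    using parts(2) by (simp add: \<pi>'(2))
  finally show ?thesis by simp
qed

text \<open>Every edge weight is at least \<open>2 * a / (K * N)\<close>, and
  \<open>circle_Poincare\<close> costs another factor \<open>N\<close>. For \<open>a\<close> of
  order \<open>1 / h\<^sup>2\<close> the resulting rate does not depend on the mesh.\<close>

lemma dissipation_bound:
  assumes \<pi>: "is_stationary \<pi>" and f: "grid_fun N f" "(\<Sum>j\<in>{0..<int N}. \<pi> j * f j) = 0"
    and a: "a > 0" "\<And>j. a \<le> \<alpha> j" "\<And>j. a \<le> \<beta> j"
    and K: "K > 0" "\<And>i j. \<pi> i \<le> K * \<pi> j"
  shows "(\<Sum>j\<in>{0..<int N}. f j * generator (\<lambda>j. \<pi> j * f j) j)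
    \<le> - (a / (K * (real N)\<^sup>2)) * (\<Sum>j\<in>{0..<int N}. \<pi> j * (f j)\<^sup>2)"
proof -
  \<comment> \<open>The mean of \<open>\<pi>\<close> over the \<open>N\<close> sites is
    \<open>1 / N\<close>, so comparability up to \<open>K\<close> forces every entry to be at least
    \<open>c\<close>.\<close>
  define c where "c = 1 / (K * real N)"
  have sum1: "(\<Sum>j\<in>{0..<int N}. \<pi> j) = 1" using \<pi> by (simp add: is_stationary_def)
  have c_le: "c \<le> \<pi> j" for j
  proof -
    have "(\<Sum>i\<in>{0..<int N}. \<pi> i) \<le> (\<Sum>i\<in>{0..<int N}. K * \<pi> j)" by (intro sum_mono K(2))
    then show ?thesis using sum1 K(1) N_pos by (simp add: c_def field_simps)
  qed
  have "c > 0" using K(1) N_pos by (simp add: c_def)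
  have weight: "2 * (a * c) \<le> \<alpha> j * \<pi> j + \<beta> (j + 1) * \<pi> (j + 1)" for j
    using mult_mono[OF a(2)[of j] c_le[of j]] mult_mono[OF a(3)[of "j + 1"] c_le[of "j + 1"]]
      rates_pos \<open>c > 0\<close> by (simp add: less_imp_le)
  have "2 * (\<Sum>j\<in>{0..<int N}. f j * generator (\<lambda>j. \<pi> j * f j) j)
      \<le> - (\<Sum>j\<in>{0..<int N}. 2 * (a * c) * (f (j + 1) - f j)\<^sup>2)"
    unfolding dissipation_identity[OF \<pi> f(1)]
    by (intro le_imp_neg_le sum_mono mult_right_mono weight) auto
  then have "2 * (\<Sum>j\<in>{0..<int N}. f j * generator (\<lambda>j. \<pi> j * f j) j)
      \<le> - (2 * (a * c) * (\<Sum>j\<in>{0..<int N}. (f (j + 1) - f j)\<^sup>2))"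
    by (simp only: sum_distrib_left)
  moreover have "a * c / real N * (\<Sum>j\<in>{0..<int N}. \<pi> j * (f j)\<^sup>2)
      \<le> a * c / real N * (real N * (\<Sum>j\<in>{0..<int N}. (f (j + 1) - f j)\<^sup>2))"
    using circle_Poincare[OF N_pos _ sum1 f(2)] stationary_pos[OF \<pi>] a(1) \<open>c > 0\<close>
    by (intro mult_left_mono) (auto simp: less_imp_le)
  moreover have "a * c / real N = a / (K * (real N)\<^sup>2)"
    by (simp add: c_def power2_eq_square)
  moreover have "a * c / real N * (real N * E) = a * c * E" for E
    using N_pos by simp
  ultimately show ?thesis by simp
qed

text \<open>Keeps \<open>p / \<pi> - 1\<close> of weighted mean zero at all times, as the Poincare
  inequality requires.\<close>

lemma mass_conservation:
  assumes p: "\<And>t. t \<ge> 0 \<Longrightarrow> grid_fun N (p t)"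
    and deriv: "\<And>t j. t \<ge> 0 \<Longrightarrow>
      ((\<lambda>u. p u j) has_real_derivative generator (p t) j) (at t within {0..})"
    and "t \<ge> 0"
  shows "(\<Sum>j\<in>{0..<int N}. p t j) = (\<Sum>j\<in>{0..<int N}. p 0 j)"
proof -
  have d: "((\<lambda>u. \<Sum>j\<in>{0..<int N}. p u j) has_real_derivative 0) (at t within {0..})"
    if "t \<ge> 0" for t
    using DERIV_sum[of "{0..<int N}" "\<lambda>u j. p u j" "generator (p t)", OF deriv[OF that]]
    by (simp add: sum_generator p that)
  have "\<exists>c. \<forall>t\<in>{0..}. (\<Sum>j\<in>{0..<int N}. p t j) = c"
    using d by (intro has_field_derivative_zero_constant) auto
  then show ?thesis
    using assms(3) by fastforce
qed

text \<open>The squared norm satisfies a Gronwall inequality with rate \<open>2 * \<kappa>\<close>;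
  the square root halves the rate.\<close>

theorem l2_decay:
  assumes p: "\<And>t. t \<ge> 0 \<Longrightarrow> grid_fun N (p t)"
    and deriv: "\<And>t j. t \<ge> 0 \<Longrightarrow>
      ((\<lambda>u. p u j) has_real_derivative generator (p t) j) (at t within {0..})"
    and mass: "(\<Sum>j\<in>{0..<int N}. p 0 j) = 1"
    and \<pi>: "is_stationary \<pi>"
    and a: "a > 0" "\<And>j. a \<le> \<alpha> j" "\<And>j. a \<le> \<beta> j"
    and K: "K > 0" "\<And>i j. \<pi> i \<le> K * \<pi> j"
    and "t \<ge> 0"
  shows "weighted_l2_norm N \<pi> (\<lambda>j. p t j / \<pi> j - 1)
    \<le> weighted_l2_norm N \<pi> (\<lambda>j. p 0 j / \<pi> j - 1) * exp (- (a / (K * (real N)\<^sup>2)) * t)"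
proof -
  define \<kappa> where "\<kappa> = a / (K * (real N)\<^sup>2)"
  define f where "f t j = p t j / \<pi> j - 1" for t j
  define F where "F t = (\<Sum>j\<in>{0..<int N}. \<pi> j * (f t j)\<^sup>2)" for t
  define F' where "F' t = 2 * (\<Sum>j\<in>{0..<int N}. f t j * generator (p t) j)" for t
  note pos = stationary_pos[OF \<pi>]
  have \<pi>': "grid_fun N \<pi>" "\<And>j. generator \<pi> j = 0" "(\<Sum>j\<in>{0..<int N}. \<pi> j) = 1"
    using \<pi> by (auto simp: is_stationary_def)
  have \<pi>f: "\<pi> j * f t j = p t j - \<pi> j" for t j
    using pos[of j] by (simp add: f_def field_simps)
  have F: "(F has_real_derivative F' t) (at t within {0..})" if "t \<ge> 0" for t
  proof -
    have f: "((\<lambda>u. f u j) has_real_derivative generator (p t) j / \<pi> j) (at t within {0..})" for j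
      unfolding f_def by (rule derivative_eq_intros DERIV_cdivide deriv[OF that] refl)+ simp
    have "((\<lambda>u. \<pi> j * (f u j)\<^sup>2) has_real_derivative 2 * (f t j * generator (p t) j))
        (at t within {0..})" for j
      using pos[of j] by (auto intro!: derivative_eq_intros f)
    from DERIV_sum[of "{0..<int N}" "\<lambda>u j. \<pi> j * (f u j)\<^sup>2", OF this]
    show ?thesis by (simp add: F_def[abs_def] F'_def sum_distrib_left)
  qed
  have F'_le: "F' t \<le> - (2 * \<kappa>) * F t" if "t \<ge> 0" for t
  proof -
    have "grid_fun N (f t)" using p[OF that] \<pi>'(1) by (simp add: grid_fun_def f_def)
    moreover have "(\<Sum>j\<in>{0..<int N}. \<pi> j * f t j) = 0"
      using mass_conservation[OF p deriv that] mass \<pi>'(3) by (simp add: \<pi>f sum_subtractf)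
    \<comment> \<open>Here \<open>\<pi> * f\<close> is \<open>p - \<pi>\<close>, and the generator
      annihilates \<open>\<pi>\<close>.\<close>
    moreover have "generator (\<lambda>j. \<pi> j * f t j) j = generator (p t) j" for j
      using \<pi>'(2)[of j] by (simp add: \<pi>f generator_def algebra_simps)
    ultimately show ?thesis
      using dissipation_bound[OF \<pi> _ _ a K, of "f t"] by (simp add: F'_def F_def \<kappa>_def)
  qed
  have "F t \<le> F 0 * exp (- (2 * \<kappa>) * t)"
    by (rule exponential_decay[OF F F'_le \<open>t \<ge> 0\<close>])
  then have "sqrt (F t) \<le> sqrt (F 0 * (exp (- \<kappa> * t))\<^sup>2)"
    by (simp add: power2_eq_square exp_add[symmetric] algebra_simps)
  then have "sqrt (F t) \<le> sqrt (F 0) * exp (- \<kappa> * t)"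
    by (simp add: real_sqrt_mult)
  moreover have "weighted_l2_norm N \<pi> (f t) = sqrt (F t)" for t
    by (simp add: weighted_l2_norm_def F_def)
  ultimately have "weighted_l2_norm N \<pi> (f t) \<le> weighted_l2_norm N \<pi> (f 0) * exp (- \<kappa> * t)"
    by simp
  then show ?thesis
    unfolding f_def[abs_def] \<kappa>_def .
qed

end

text \<open>Cauchy-Schwarz after splitting off one factor \<open>sqrt (w j)\<close>, whose L2 norm
  is one.\<close>

lemma weighted_l1_le_l2:
  fixes w f :: "int \<Rightarrow> real"
  assumes "\<And>j. w j \<ge> 0" "(\<Sum>j\<in>{0..<int N}. w j) = 1"
  shows "(\<Sum>j\<in>{0..<int N}. w j * \<bar>f j\<bar>) \<le> weighted_l2_norm N w f"
proof -
  have "(\<Sum>j\<in>{0..<int N}. w j * \<bar>f j\<bar>)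
      = (\<Sum>j\<in>{0..<int N}. sqrt (w j) * (sqrt (w j) * \<bar>f j\<bar>))"
    using assms(1) by (simp add: mult.assoc[symmetric])
  also have "\<dots> \<le> L2_set (\<lambda>j. sqrt (w j)) {0..<int N} * L2_set (\<lambda>j. sqrt (w j) * \<bar>f j\<bar>) {0..<int N}"
    using L2_set_mult_ineq[of "\<lambda>j. sqrt (w j)" "\<lambda>j. sqrt (w j) * \<bar>f j\<bar>" "{0..<int N}"] assms(1)
    by (simp add: abs_mult)
  also have "\<dots> = weighted_l2_norm N w f"
    using assms by (simp add: weighted_l2_norm_def L2_set_def power_mult_distrib)
  finally show ?thesis .
qed

section \<open>The rates of the upwind scheme\<close>

lemma smooth_on_torus_imp_continuous:
  assumes "smooth_on_torus L f"
  shows "continuous_on S ((deriv ^^ n) f)"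
  using assms unfolding smooth_on_torus_def
  by (meson continuous_at_imp_continuous_on field_differentiable_imp_continuous_at)

lemma deriv_periodic:
  assumes "\<And>x. f (x + L) = f x"
  shows "deriv f (x + L) = deriv f x"
  by (simp add: deriv_def DERIV_shift assms)

lemma drift_periodic:
  assumes "smooth_on_torus L b" "smooth_on_torus L \<sigma>"
  shows "drift b \<sigma> (x + L) = drift b \<sigma> x"
  using assms deriv_periodic[of \<sigma> L x] by (simp add: drift_def smooth_on_torus_def)

lemma drift_bounded:
  assumes "smooth_on_torus L b" "smooth_on_torus L \<sigma>"
  obtains M where "M \<ge> 0" "\<forall>x\<in>{0..L}. \<bar>drift b \<sigma> x\<bar> \<le> M"
proof -
  have "continuous_on {0..L} (drift b \<sigma>)"
    unfolding drift_def[abs_def]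
    using smooth_on_torus_imp_continuous[OF assms(1), of _ 0]
      smooth_on_torus_imp_continuous[OF assms(2), of _ 0]
      smooth_on_torus_imp_continuous[OF assms(2), of _ 1]
    by (intro continuous_intros) auto
  then have "bounded (drift b \<sigma> ` {0..L})"
    by (intro compact_imp_bounded compact_continuous_image) auto
  then obtain M where "M > 0" "\<forall>x\<in>{0..L}. \<bar>drift b \<sigma> x\<bar> \<le> M"
    unfolding bounded_pos by auto
  then show ?thesis using that[of M] by auto
qed

lemma grid_pt_add:
  assumes "N > 0"
  shows "grid_pt L N (j + int N) = grid_pt L N j + L"
  using assms by (simp add: grid_pt_def mesh_def field_simps)

lemma grid_fun_grid_pt:
  assumes "N > 0" "\<And>x. f (x + L) = f x"
  shows "grid_fun N (\<lambda>j. f (grid_pt L N j))"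
  using assms by (simp add: grid_fun_def grid_pt_add)

text \<open>Reducing the index modulo \<open>N\<close> moves the grid point into
  \<open>{0..L}\<close>.\<close>

lemma abs_grid_pt_le:
  fixes s :: "real \<Rightarrow> real"
  assumes "L > 0" "N > 0" "\<And>x. s (x + L) = s x"
    and "\<forall>x\<in>{0..L}. \<bar>s x\<bar> \<le> M"
  shows "\<bar>s (grid_pt L N j)\<bar> \<le> M"
proof -
  have "0 \<le> j mod int N" "j mod int N < int N" using assms(2) by auto
  then have "0 \<le> real_of_int (j mod int N)" "real_of_int (j mod int N) \<le> real N"
    by linarith+
  then have "grid_pt L N (j mod int N) \<in> {0..L}"
    using assms(1,2) by (simp add: grid_pt_def mesh_def field_simps mult_left_mono)
  then show ?thesis
    using assms(4) grid_fun_mod[OF grid_fun_grid_pt[OF assms(2), of s L], of j] assms(3) by metis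
qed

text \<open>The upwind drift terms are nonnegative, so the diffusive terms alone give the lower
  bounds and positivity.\<close>

lemma upwind_rates_cyclic_chain:
  assumes "L > 0" "N > 0" "smooth_on_torus L b" "smooth_on_torus L \<sigma>" "S > 0" "\<And>x. (\<sigma> x)\<^sup>2 \<ge> S"
  shows "cyclic_chain N (rate_right L N b \<sigma>) (rate_left L N b \<sigma>)"
    and "S / (2 * (mesh L N)\<^sup>2) \<le> rate_right L N b \<sigma> j"
    and "S / (2 * (mesh L N)\<^sup>2) \<le> rate_left L N b \<sigma> j"
proof -
  have h: "mesh L N > 0" using assms(1,2) by (simp add: mesh_def)
  have lower: "S / (2 * (mesh L N)\<^sup>2) \<le> rate_right L N b \<sigma> j"
    "S / (2 * (mesh L N)\<^sup>2) \<le> rate_left L N b \<sigma> j" for j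
    unfolding rate_right_def rate_left_def using h assms(6)
    by (auto intro!: add_increasing divide_right_mono)
  then show "S / (2 * (mesh L N)\<^sup>2) \<le> rate_right L N b \<sigma> j"
    "S / (2 * (mesh L N)\<^sup>2) \<le> rate_left L N b \<sigma> j" by auto
  have S: "0 < S / (2 * (mesh L N)\<^sup>2)" using h assms(5) by simp
  have \<sigma>: "\<sigma> (x + L) = \<sigma> x" for x using assms(4) by (simp add: smooth_on_torus_def)
  note d = drift_periodic[OF assms(3,4)]
  have "\<sigma> (x + L + c) = \<sigma> (x + c)" for x c
    using \<sigma>[of "x + c"] by (simp add: algebra_simps)
  moreover have "\<sigma> (x + L - c) = \<sigma> (x - c)" for x c
    using \<sigma>[of "x - c"] by (simp add: algebra_simps)
  ultimately have "grid_fun N (rate_right L N b \<sigma>)" "grid_fun N (rate_left L N b \<sigma>)"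
    by (simp_all add: grid_fun_def rate_right_def rate_left_def grid_pt_add[OF assms(2)] d)
  then show "cyclic_chain N (rate_right L N b \<sigma>) (rate_left L N b \<sigma>)"
    using S lower assms(2) by unfold_locales (auto intro: less_le_trans)
qed

text \<open>The two rates across an edge share the diffusive term \<open>D\<close>, of order
  \<open>1 / h\<^sup>2\<close>, and differ only by drift terms of size at most \<open>M / h\<close>,
  a relative error of order \<open>h\<close>.\<close>

lemma upwind_rates_ratio:
  assumes "L > 0" "N > 0" "S > 0" "\<And>x. (\<sigma> x)\<^sup>2 \<ge> S"
    and M: "\<And>j. \<bar>drift b \<sigma> (grid_pt L N j)\<bar> \<le> M"
  shows "rate_right L N b \<sigma> j \<le> (1 + 2 * M / S * mesh L N) * rate_left L N b \<sigma> (j + 1)"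
    and "rate_left L N b \<sigma> (j + 1) \<le> (1 + 2 * M / S * mesh L N) * rate_right L N b \<sigma> j"
proof -
  define h where "h = mesh L N"
  define D where "D = (\<sigma> (grid_pt L N j + h / 2))\<^sup>2 / (2 * h\<^sup>2)"
  have h: "h > 0" using assms(1,2) by (simp add: mesh_def h_def)
  have "M \<ge> 0" using M[of 0] by linarith
  \<comment> \<open>Both rates evaluate \<open>\<sigma>\<close> at the midpoint of the same
    edge.\<close>
  have mid: "grid_pt L N (j + 1) - h / 2 = grid_pt L N j + h / 2"
    by (simp add: grid_pt_def h_def algebra_simps)
  have "S / (2 * h\<^sup>2) \<le> D" unfolding D_def using assms(4) by (intro divide_right_mono) auto
  \<comment> \<open>The factor \<open>2 * M / S * h\<close> is the one that turns
    \<open>S / (2 * h\<^sup>2)\<close> into \<open>M / h\<close>.\<close>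
  then have "2 * M / S * h * (S / (2 * h\<^sup>2)) \<le> 2 * M / S * h * D"
    using \<open>M \<ge> 0\<close> assms(3) h by (intro mult_left_mono) auto
  then have MD: "M / h \<le> 2 * M / S * h * D"
    using h assms(3) by (simp add: power2_eq_square)
  have bound: "x / h + D \<le> (1 + 2 * M / S * h) * (y / h + D)" if "x \<le> M" "0 \<le> y" for x y
  proof -
    have "x / h + D \<le> M / h + D" using that h by (simp add: divide_right_mono)
    also have "\<dots> \<le> (1 + 2 * M / S * h) * D" using MD by (simp add: algebra_simps)
    also have "\<dots> \<le> (1 + 2 * M / S * h) * (y / h + D)"
      using that h \<open>M \<ge> 0\<close> assms(3) by (intro mult_left_mono) auto
    finally show ?thesis .
  qed
  have r: "rate_right L N b \<sigma> j = max (drift b \<sigma> (grid_pt L N j)) 0 / h + D"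
    and l: "rate_left L N b \<sigma> (j + 1) = max (- drift b \<sigma> (grid_pt L N (j + 1))) 0 / h + D"
    unfolding rate_right_def rate_left_def h_def[symmetric] mid D_def by simp_all
  have "max (drift b \<sigma> (grid_pt L N j)) 0 \<le> M" "max (- drift b \<sigma> (grid_pt L N (j + 1))) 0 \<le> M"
    using M[of j] M[of "j + 1"] \<open>M \<ge> 0\<close> by auto
  then show "rate_right L N b \<sigma> j \<le> (1 + 2 * M / S * mesh L N) * rate_left L N b \<sigma> (j + 1)"
    "rate_left L N b \<sigma> (j + 1) \<le> (1 + 2 * M / S * mesh L N) * rate_right L N b \<sigma> j"
    unfolding r l h_def[symmetric] by (intro bound; simp)+
qed

text \<open>From \<open>1 + x \<le> exp x\<close> and \<open>N * h = L\<close>; this removes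
  \<open>N\<close> from the Harnack constant.\<close>

lemma power_mesh_le_exp:
  assumes "N > 0" "C \<ge> 0" "L > 0"
  shows "(1 + C * mesh L N) ^ N \<le> exp (C * L)"
proof -
  have "(1 + C * mesh L N) ^ N \<le> exp (C * mesh L N) ^ N"
    using assms by (intro power_mono exp_ge_add_one_self) (simp add: mesh_def)
  also have "\<dots> = exp (C * L)"
    using assms(1) by (simp add: exp_of_nat_mult[symmetric] mesh_def)
  finally show ?thesis .
qed

section \<open>Decay for the upwind scheme\<close>

lemma upwind_decay:
  assumes LN: "L > 0" "N > 0"
    and smooth: "smooth_on_torus L b" "smooth_on_torus L \<sigma>"
    and S: "S > 0" "\<And>x. (\<sigma> x)\<^sup>2 \<ge> S"
    and M: "M \<ge> 0" "\<forall>x\<in>{0..L}. \<bar>drift b \<sigma> x\<bar> \<le> M"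
    and \<rho>: "upwind_solution L N b \<sigma> \<rho>" "\<And>j. \<rho> 0 j \<ge> 0" "\<exists>j. \<rho> 0 j \<noteq> 0"
  shows "stationary L N b \<sigma> j > 0"
    and "(\<Sum>j\<in>{0..<int N}. stationary L N b \<sigma> j) = 1"
    and "l1_norm L N (\<rho> 0) > 0"
    and "t \<ge> 0 \<Longrightarrow> weighted_l2_norm N (stationary L N b \<sigma>) (\<lambda>j. rel_density L N b \<sigma> \<rho> t j - 1)
      \<le> weighted_l2_norm N (stationary L N b \<sigma>) (\<lambda>j. rel_density L N b \<sigma> \<rho> 0 j - 1)
        * exp (- (S / (2 * exp (2 * M / S * L) * L\<^sup>2)) * t)"
proof -
  interpret cyclic_chain N "rate_right L N b \<sigma>" "rate_left L N b \<sigma>"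
    by (rule upwind_rates_cyclic_chain[OF LN smooth S])
  define \<pi> where "\<pi> = stationary L N b \<sigma>"
  define K where "K = exp (2 * M / S * L)"
  define Z where "Z = l1_norm L N (\<rho> 0)"
  define p where "p = normalized L N \<rho>"
  have h: "mesh L N > 0" using LN by (simp add: mesh_def)
  have op: "upwind_op L N b \<sigma> = generator"
    by (simp add: fun_eq_iff upwind_op_def generator_def)
  have "\<exists>!v. is_stationary v"
    using stationary_exists stationary_unique by blast
  then have \<pi>: "is_stationary \<pi>"
    unfolding \<pi>_def stationary_def op is_stationary_def by (rule theI')
  show "stationary L N b \<sigma> j > 0" "(\<Sum>j\<in>{0..<int N}. stationary L N b \<sigma> j) = 1"
    using stationary_pos[OF \<pi>, of j] \<pi> by (auto simp: \<pi>_def is_stationary_def)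
  have grid: "grid_fun N (\<rho> t)" and deriv: "((\<lambda>u. \<rho> u j) has_real_derivative generator (\<rho> t) j)
      (at t within {0..})" if "t \<ge> 0" for t j
    using \<rho>(1) that by (auto simp: upwind_solution_def op)
  obtain i where "\<rho> 0 i > 0" using \<rho>(2,3) by (metis order_le_less)
  \<comment> \<open>The positive entry may lie outside the summation range and is moved into
    it.\<close>
  then have "\<rho> 0 (i mod int N) > 0" using grid_fun_mod[OF grid, of 0 i] by simp
  then have "0 < (\<Sum>j\<in>{0..<int N}. mesh L N * \<bar>\<rho> 0 j\<bar>)"
    using h N_pos by (intro sum_pos2[of _ "i mod int N"]) auto
  then show Z: "l1_norm L N (\<rho> 0) > 0" by (simp add: l1_norm_def)
  have "Z = (\<Sum>j\<in>{0..<int N}. mesh L N * \<rho> 0 j)"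
    using \<rho>(2) by (simp add: Z_def l1_norm_def)
  then have mass: "(\<Sum>j\<in>{0..<int N}. p 0 j) = 1"
    using Z by (simp add: p_def normalized_def Z_def[symmetric] sum_divide_distrib[symmetric])
  have p_grid: "grid_fun N (p t)" if "t \<ge> 0" for t
    using grid[OF that] by (simp add: p_def grid_fun_def normalized_def)
  have gen_p: "mesh L N * generator (\<rho> t) j / Z = generator (p t) j" for t j
    by (simp add: p_def normalized_def generator_def Z_def algebra_simps
        add_divide_distrib diff_divide_distrib)
  have p_deriv: "((\<lambda>u. p u j) has_real_derivative generator (p t) j) (at t within {0..})"
    if "t \<ge> 0" for t j
    unfolding gen_p[symmetric] unfolding p_def normalized_def Z_def[symmetric]
    by (intro DERIV_cdivide DERIV_cmult deriv that)
  have M': "\<bar>drift b \<sigma> (grid_pt L N j)\<bar> \<le> M" for j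
    by (rule abs_grid_pt_le[where s = "drift b \<sigma>", OF LN drift_periodic[OF smooth] M(2)])
  have K: "\<pi> i \<le> K * \<pi> j" for i j
  proof -
    have "\<pi> i \<le> (1 + 2 * M / S * mesh L N) ^ N * \<pi> j"
      using M(1) S(1) h
      by (intro stationary_Harnack[OF \<pi>] upwind_rates_ratio[OF LN S M']) auto
    also have "\<dots> \<le> K * \<pi> j"
      unfolding K_def using LN M(1) S(1) stationary_pos[OF \<pi>, of j]
      by (intro mult_right_mono power_mesh_le_exp) auto
    finally show ?thesis .
  qed
  \<comment> \<open>Since \<open>h * N = L\<close>, the two powers of \<open>N\<close> cancel and
    the rate is free of the mesh.\<close>
  have rate: "S / (2 * (mesh L N)\<^sup>2) / (K * (real N)\<^sup>2) = S / (2 * K * L\<^sup>2)"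
    using N_pos by (simp add: mesh_def power_divide)
  show "weighted_l2_norm N (stationary L N b \<sigma>) (\<lambda>j. rel_density L N b \<sigma> \<rho> t j - 1)
      \<le> weighted_l2_norm N (stationary L N b \<sigma>) (\<lambda>j. rel_density L N b \<sigma> \<rho> 0 j - 1)
        * exp (- (S / (2 * exp (2 * M / S * L) * L\<^sup>2)) * t)" if "t \<ge> 0"
    using l2_decay[OF p_grid p_deriv mass \<pi> _ upwind_rates_cyclic_chain(2,3)[OF LN smooth S] _ K that]
      S(1) h
    unfolding rate by (simp add: rel_density_def p_def \<pi>_def K_def)
qed

theorem theorem6p2:
  fixes L S\<^sub>1 :: real and b \<sigma> :: "real \<Rightarrow> real"
  assumes "L > 0"
    and "smooth_on_torus L b" and "smooth_on_torus L \<sigma>"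
    and "S\<^sub>1 > 0" and "\<And>x. (\<sigma> x)\<^sup>2 \<ge> S\<^sub>1"
  shows "\<exists>h\<^sub>0>0. \<exists>\<kappa>\<^sub>1>0. \<forall>N::nat. N > 0 \<longrightarrow> mesh L N \<le> h\<^sub>0 \<longrightarrow>
    (\<forall>\<rho>. upwind_solution L N b \<sigma> \<rho> \<longrightarrow> (\<forall>j. \<rho> 0 j \<ge> 0) \<longrightarrow> (\<exists>j. \<rho> 0 j \<noteq> 0) \<longrightarrow>
      (\<forall>t\<ge>0. weighted_l2_norm N (stationary L N b \<sigma>) (\<lambda>j. rel_density L N b \<sigma> \<rho> t j - 1)
         \<le> weighted_l2_norm N (stationary L N b \<sigma>) (\<lambda>j. rel_density L N b \<sigma> \<rho> 0 j - 1)
            * exp (- \<kappa>\<^sub>1 * t)) \<and>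
      (\<exists>C. \<forall>t\<ge>0. (\<Sum>j\<in>{0..<int N}. \<bar>normalized L N \<rho> t j - stationary L N b \<sigma> j\<bar>)
         \<le> C * exp (- \<kappa>\<^sub>1 * t)) \<and>
      (\<exists>C. \<forall>t\<ge>0. l1_norm L N (\<lambda>j. \<rho> t j
             - 1 / mesh L N * l1_norm L N (\<rho> 0) * stationary L N b \<sigma> j)
         \<le> C * exp (- \<kappa>\<^sub>1 * t)))"
proof -
  obtain M where M: "M \<ge> 0" "\<forall>x\<in>{0..L}. \<bar>drift b \<sigma> x\<bar> \<le> M"
    using drift_bounded[OF assms(2,3)] by blast
  \<comment> \<open>Depends only on \<open>L\<close>, \<open>S\<^sub>1\<close> and the drift bound
    \<open>M\<close>, so it is fixed before \<open>N\<close> and \<open>\<rho>\<close>.\<close>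
  define \<kappa> where "\<kappa> = S\<^sub>1 / (2 * exp (2 * M / S\<^sub>1 * L) * L\<^sup>2)"
  have "\<kappa> > 0" using assms(1,4) by (simp add: \<kappa>_def)
  \<comment> \<open>The witness for \<open>h\<^sub>0\<close> is simply \<open>1\<close>.\<close>
  show ?thesis
  proof (rule exI[of _ 1], rule conjI[OF zero_less_one], rule exI[of _ \<kappa>],
      rule conjI[OF \<open>\<kappa> > 0\<close>], intro allI impI conjI)
    fix N :: nat and \<rho> :: "real \<Rightarrow> int \<Rightarrow> real"
    assume N: "N > 0" and \<rho>: "upwind_solution L N b \<sigma> \<rho>" "\<forall>j. \<rho> 0 j \<ge> 0" "\<exists>j. \<rho> 0 j \<noteq> 0"
    let ?\<pi> = "stationary L N b \<sigma>"
    let ?Z = "l1_norm L N (\<rho> 0)"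
    let ?n = "\<lambda>t. weighted_l2_norm N ?\<pi> (\<lambda>j. rel_density L N b \<sigma> \<rho> t j - 1)"
    note facts = upwind_decay[OF assms(1) N assms(2-5) M \<rho>(1) \<rho>(2)[rule_format] \<rho>(3), folded \<kappa>_def]
    show decay: "?n t \<le> ?n 0 * exp (- \<kappa> * t)" if "t \<ge> 0" for t
      by (rule facts(4)[OF that])
    have h: "mesh L N > 0" using N assms(1) by (simp add: mesh_def)
    have tv: "(\<Sum>j\<in>{0..<int N}. \<bar>normalized L N \<rho> t j - ?\<pi> j\<bar>) \<le> ?n 0 * exp (- \<kappa> * t)"
      if "t \<ge> 0" for t
    proof -
      \<comment> \<open>Total variation becomes the weighted L1 norm of \<open>q - 1\<close>, which
        the L2 norm dominates; the constant is the initial L2 distance.\<close>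
      have "\<bar>normalized L N \<rho> t j - ?\<pi> j\<bar> = ?\<pi> j * \<bar>rel_density L N b \<sigma> \<rho> t j - 1\<bar>" for j
      proof -
        have "normalized L N \<rho> t j - ?\<pi> j = ?\<pi> j * (rel_density L N b \<sigma> \<rho> t j - 1)"
          using facts(1)[of j] by (simp add: rel_density_def field_simps)
        then show ?thesis using facts(1)[of j] by (simp add: abs_mult)
      qed
      then have "(\<Sum>j\<in>{0..<int N}. \<bar>normalized L N \<rho> t j - ?\<pi> j\<bar>) \<le> ?n t"
        using weighted_l1_le_l2[OF less_imp_le[OF facts(1)] facts(2)] by simp
      then show ?thesis using decay[OF that] by linarith
    qed
    then show "\<exists>C. \<forall>t\<ge>0. (\<Sum>j\<in>{0..<int N}. \<bar>normalized L N \<rho> t j - ?\<pi> j\<bar>) \<le> C * exp (- \<kappa> * t)"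
      by blast
    have "l1_norm L N (\<lambda>j. \<rho> t j - 1 / mesh L N * ?Z * ?\<pi> j) \<le> ?Z * ?n 0 * exp (- \<kappa> * t)"
      if "t \<ge> 0" for t
    proof -
      \<comment> \<open>Undoing the normalization multiplies the constant by the initial
        mass.\<close>
      have "mesh L N * \<bar>\<rho> t j - 1 / mesh L N * ?Z * ?\<pi> j\<bar> = ?Z * \<bar>normalized L N \<rho> t j - ?\<pi> j\<bar>" for j
      proof -
        have "mesh L N * (\<rho> t j - 1 / mesh L N * ?Z * ?\<pi> j) = ?Z * (normalized L N \<rho> t j - ?\<pi> j)"
          using h facts(3) by (simp add: normalized_def field_simps)
        then show ?thesis using h facts(3) by (metis abs_mult abs_of_pos)
      qed
      then have "l1_norm L N (\<lambda>j. \<rho> t j - 1 / mesh L N * ?Z * ?\<pi> j)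
          = ?Z * (\<Sum>j\<in>{0..<int N}. \<bar>normalized L N \<rho> t j - ?\<pi> j\<bar>)"
        by (simp add: l1_norm_def sum_distrib_left)
      also have "\<dots> \<le> ?Z * (?n 0 * exp (- \<kappa> * t))"
        using tv[OF that] facts(3) by (intro mult_left_mono) auto
      finally show ?thesis by (simp add: mult.assoc)
    qed
    then show "\<exists>C. \<forall>t\<ge>0. l1_norm L N (\<lambda>j. \<rho> t j - 1 / mesh L N * ?Z * ?\<pi> j) \<le> C * exp (- \<kappa> * t)"
      by blast
  qed
qed

end
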